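(* Let $D$ be an integral domain with quotient field $K$. Then $\mathrm{Over_{qr}}(D)$ is proconstructible in $\mathrm{Over}(D)$ if and only if, for every $x\in K$, the ideal $\mathrm{rad}((D:_Dx))$ is the radical of a principal ideal of $D$.
   Context: A spectral space is a topological space homeomorphic to the prime spectrum of a commutative unitary ring with the Zariski topology. If $X$ is a spectral space, the constructible topology on $X$ is the coarsest topology in which all open and compact subsets of $X$ (in the original topology; "compact" does not include Hausdorff) are both open and closed; a subset $Y\subseteq X$ is proconstructible if it is closed in the constructible topology. An overring of $D$ is a ring $T$ with $D\subseteq T\subseteq K$; $\mathrm{Over}(D)$ is the set of all overrings of $D$, endowed with the Zariski topology, which has as a basis of open sets the sets $\mathcal{B}(x_1,\ldots,x_n):=\{T\in\mathrm{Over}(D)\mid x_1,\ldots,x_n\in T\}$, as $x_1,\ldots,x_n$ range in $K$. It is known that $\mathrm{Over}(D)$ is a spectral space. A quotient ring of $D$ is an overring of the form $S^{-1}D$ for some multiplicatively closed subset $S$ of $D$ (with $0\notin S$); $\mathrm{Over_{qr}}(D)$ is the set of all quotient rings of $D$. For $x\in K$, $(D:_Dx):=\{d\in D\mid dx\in D\}$. *)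

theory Defs
  imports
    "HOL-Algebra.Subrings"
    "HOL-Algebra.Ideal"
    "HOL-Analysis.Abstract_Topology"
begin

section \<open>Domains inside their quotient field, overrings, quotient rings\<close>

text \<open>
  The domain \<open>D\<close> is a subset of the carrier of its quotient field \<open>K\<close>; as a ring in its own right it
  is \<open>K\<lparr>carrier := D\<rparr>\<close>. Overrings of \<open>D\<close> are then literally subsets of the carrier of \<open>K\<close>.
\<close>

definition quotient_field_of :: "('a, 'b) ring_scheme \<Rightarrow> 'a set \<Rightarrow> bool" where
  "quotient_field_of K D \<longleftrightarrow>
     field K \<and> subdomain D K \<and>
     (\<forall>x\<in>carrier K. \<exists>a\<in>D. \<exists>b\<in>D - {\<zero>\<^bsub>K\<^esub>}. x = a \<otimes>\<^bsub>K\<^esub> inv\<^bsub>K\<^esub> b)"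

definition overrings :: "('a, 'b) ring_scheme \<Rightarrow> 'a set \<Rightarrow> 'a set set" where
  "overrings K D = {T. subring T K \<and> D \<subseteq> T}"

text \<open>Multiplicatively closed sets contain \<open>\<one>\<close>, as \<^const>\<open>submonoid\<close> requires.\<close>

definition localization :: "('a, 'b) ring_scheme \<Rightarrow> 'a set \<Rightarrow> 'a set \<Rightarrow> 'a set" where
  "localization K D S = {inv\<^bsub>K\<^esub> s \<otimes>\<^bsub>K\<^esub> d | s d. s \<in> S \<and> d \<in> D}"

definition quotient_overrings :: "('a, 'b) ring_scheme \<Rightarrow> 'a set \<Rightarrow> 'a set set" where
  "quotient_overrings K D =
     {T \<in> overrings K D.
        \<exists>S. submonoid S (K\<lparr>carrier := D\<rparr>) \<and> \<zero>\<^bsub>K\<^esub> \<notin> S \<and> T = localization K D S}"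

definition colon_ideal :: "('a, 'b) ring_scheme \<Rightarrow> 'a set \<Rightarrow> 'a \<Rightarrow> 'a set" where
  "colon_ideal K D x = {d \<in> D. d \<otimes>\<^bsub>K\<^esub> x \<in> D}"

definition radical :: "('a, 'b) ring_scheme \<Rightarrow> 'a set \<Rightarrow> 'a set" where
  "radical R I = {a \<in> carrier R. \<exists>n::nat. n > 0 \<and> a [^]\<^bsub>R\<^esub> n \<in> I}"

lemma colon_ideal_ideal:
  fixes K (structure)
  assumes "quotient_field_of K D" "x \<in> carrier K"
  shows "ideal (colon_ideal K D x) (K\<lparr>carrier := D\<rparr>)"
proof -
  interpret field K using assms(1) by (simp add: quotient_field_of_def)
  have sD: "subring D K"
    using assms(1) by (auto simp: quotient_field_of_def subdomain_def subcring_def)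
  note DE = subringE[OF sD]
  have D: "d \<in> carrier K" if "d \<in> D" for d using DE(1) that by blast
  interpret R: ring "K\<lparr>carrier := D\<rparr>" using sD by (rule subring_is_ring)
  have inv_eq: "inv\<^bsub>add_monoid (K\<lparr>carrier := D\<rparr>)\<^esub> d = \<ominus> d" if "d \<in> D" for d
    using R.minus_equality[of "\<ominus> d" d] DE(5) that D by (simp add: a_inv_def l_neg)
  show ?thesis
  proof (rule idealI)
    show "ring (K\<lparr>carrier := D\<rparr>)" by (rule R.ring_axioms)
    show "subgroup (colon_ideal K D x) (add_monoid (K\<lparr>carrier := D\<rparr>))"
    proof
      show "colon_ideal K D x \<subseteq> carrier (add_monoid (K\<lparr>carrier := D\<rparr>))"
        by (auto simp: colon_ideal_def)
      show "\<one>\<^bsub>add_monoid (K\<lparr>carrier := D\<rparr>)\<^esub> \<in> colon_ideal K D x"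
        using assms(2) DE(2) by (simp add: colon_ideal_def)
      show "a \<otimes>\<^bsub>add_monoid (K\<lparr>carrier := D\<rparr>)\<^esub> b \<in> colon_ideal K D x"
        if "a \<in> colon_ideal K D x" "b \<in> colon_ideal K D x" for a b
        using that assms(2) DE(7) D by (simp add: colon_ideal_def l_distr)
      show "inv\<^bsub>add_monoid (K\<lparr>carrier := D\<rparr>)\<^esub> a \<in> colon_ideal K D x"
        if "a \<in> colon_ideal K D x" for a
        using that assms(2) DE(5) D inv_eq by (simp add: colon_ideal_def l_minus)
    qed
    fix a d
    assume a: "a \<in> colon_ideal K D x" and d: "d \<in> carrier (K\<lparr>carrier := D\<rparr>)"
    have "d \<otimes> a \<in> colon_ideal K D x"
      using a d assms(2) DE(6) D by (simp add: colon_ideal_def m_assoc)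
    moreover have "a \<otimes> d = d \<otimes> a"
      using a d D by (simp add: colon_ideal_def m_comm)
    ultimately show "d \<otimes>\<^bsub>K\<lparr>carrier := D\<rparr>\<^esub> a \<in> colon_ideal K D x"
      and "a \<otimes>\<^bsub>K\<lparr>carrier := D\<rparr>\<^esub> d \<in> colon_ideal K D x"
      by simp_all
  qed
qed


section \<open>The Zariski topology on the set of overrings\<close>

definition zariski_basic :: "('a, 'b) ring_scheme \<Rightarrow> 'a set \<Rightarrow> 'a set \<Rightarrow> 'a set set" where
  "zariski_basic K D F = {T \<in> overrings K D. F \<subseteq> T}"

definition zariski_topology :: "('a, 'b) ring_scheme \<Rightarrow> 'a set \<Rightarrow> 'a set topology" where
  "zariski_topology K D =
     topology_generated_by {zariski_basic K D F | F. finite F \<and> F \<subseteq> carrier K}"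

text \<open>The generating sets are a basis and not just a subbasis.\<close>

lemma openin_zariski_topology_iff:
  "openin (zariski_topology K D) U \<longleftrightarrow>
     (\<exists>\<F>. (\<forall>F\<in>\<F>. finite F \<and> F \<subseteq> carrier K) \<and> U = (\<Union>F\<in>\<F>. zariski_basic K D F))"
  (is "_ \<longleftrightarrow> ?P U")
proof
  assume "openin (zariski_topology K D) U"
  then have "generate_topology_on {zariski_basic K D F | F. finite F \<and> F \<subseteq> carrier K} U"
    by (simp add: zariski_topology_def openin_topology_generated_by_iff)
  then show "?P U"
  proof (induction rule: generate_topology_on.induct)
    case Empty
    show ?case by (rule exI[of _ "{}"]) simp
  next
    case (Int a b)
    then obtain A B where A: "\<forall>F\<in>A. finite F \<and> F \<subseteq> carrier K" "a = (\<Union>F\<in>A. zariski_basic K D F)"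
      and B: "\<forall>F\<in>B. finite F \<and> F \<subseteq> carrier K" "b = (\<Union>F\<in>B. zariski_basic K D F)"
      by blast
    have "zariski_basic K D (F \<union> G) = zariski_basic K D F \<inter> zariski_basic K D G" for F G
      by (auto simp: zariski_basic_def)
    then have "a \<inter> b = (\<Union>H\<in>(\<lambda>(F, G). F \<union> G) ` (A \<times> B). zariski_basic K D H)"
      using A(2) B(2) by auto
    moreover have "\<forall>H\<in>(\<lambda>(F, G). F \<union> G) ` (A \<times> B). finite H \<and> H \<subseteq> carrier K"
      using A(1) B(1) by auto
    ultimately show ?case by blast
  next
    case (UN \<K>)
    then obtain f where f: "\<And>k. k \<in> \<K> \<Longrightarrow>
        (\<forall>F\<in>f k. finite F \<and> F \<subseteq> carrier K) \<and> k = (\<Union>F\<in>f k. zariski_basic K D F)"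
      by metis
    have "\<Union>\<K> = (\<Union>k\<in>\<K>. \<Union>F\<in>f k. zariski_basic K D F)"
      using f by auto
    then show ?case
      using f by (intro exI[of _ "\<Union>k\<in>\<K>. f k"]) auto
  next
    case (Basis s)
    then obtain F where "finite F" "F \<subseteq> carrier K" "s = zariski_basic K D F" by blast
    then show ?case by (intro exI[of _ "{F}"]) simp
  qed
next
  have "openin (zariski_topology K D) (zariski_basic K D F)"
    if "finite F" "F \<subseteq> carrier K" for F
    unfolding zariski_topology_def using that by (intro topology_generated_by_Basis) auto
  moreover assume "?P U"
  ultimately show "openin (zariski_topology K D) U"
    by (auto intro!: openin_Union)
qed

lemma topspace_zariski_topology [simp]: "topspace (zariski_topology K D) = overrings K D"
  by (auto simp: zariski_topology_def zariski_basic_def)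


section \<open>The constructible topology\<close>

definition constructible_topology :: "'a topology \<Rightarrow> 'a topology" where
  "constructible_topology X =
     topology_generated_by
       (\<Union>U\<in>{U. openin X U \<and> compactin X U}. {U, topspace X - U})"

definition proconstructible_in :: "'a topology \<Rightarrow> 'a set \<Rightarrow> bool" where
  "proconstructible_in X Y \<longleftrightarrow> closedin (constructible_topology X) Y"

lemma topspace_constructible_topology [simp]:
  "topspace (constructible_topology X) = topspace X"
  by (auto simp: constructible_topology_def dest: openin_subset intro!: exI[of _ "{}"])

lemma constructible_topology_clopen:
  assumes "openin X U" "compactin X U"
  shows "openin (constructible_topology X) U" "closedin (constructible_topology X) U"
proof -
  show "openin (constructible_topology X) U"
    unfolding constructible_topology_def using assms by (intro topology_generated_by_Basis) auto
  have "openin (constructible_topology X) (topspace X - U)"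
    unfolding constructible_topology_def using assms by (intro topology_generated_by_Basis) auto
  then show "closedin (constructible_topology X) U"
    using assms(1) by (simp add: closedin_def openin_subset)
qed

lemma constructible_topology_coarsest:
  assumes "topspace Y = topspace X"
    and "\<And>U. openin X U \<Longrightarrow> compactin X U \<Longrightarrow> openin Y U \<and> closedin Y U"
    and "openin (constructible_topology X) V"
  shows "openin Y V"
proof -
  have "generate_topology_on (\<Union>U\<in>{U. openin X U \<and> compactin X U}. {U, topspace X - U}) V"
    using assms(3) by (simp add: constructible_topology_def openin_topology_generated_by_iff)
  then show ?thesis
    by (induction rule: generate_topology_on.induct)
       (use assms(1,2) in \<open>auto simp: closedin_def\<close>)
qed

end

theory Submission
  imports Defs "HOL-Algebra.Generated_Rings" "HOL-Analysis.Function_Topology"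
begin

text \<open>
  An overring \<open>T\<close> of \<open>D\<close> is a quotient ring iff every \<open>x \<in> T\<close> has a denominator \<open>s \<in> (D : x)\<close> that is
  invertible in \<open>T\<close> (\<open>quotient_overring_iff\<close>). So the quotient rings are cut out by the
  conditions ``\<open>x \<notin> T\<close>, or \<open>inv s \<in> T\<close> for some nonzero \<open>s \<in> (D : x)\<close>'', one for each \<open>x\<close>. Each set
  \<open>{T. x \<in> T}\<close> is open and compact, hence clopen in the constructible topology, but the union of the
  sets \<open>{T. inv s \<in> T}\<close> over all \<open>s\<close> is in general only open. The theorem says that the quotient rings
  form a closed set exactly when, for each \<open>x\<close>, a single one of these sets contains all quotient
  rings that contain \<open>x\<close>.

  If \<open>rad (D : x) = rad (a D)\<close>, then some \<open>s \<in> (D : x)\<close> is invertible in \<open>T\<close> iff \<open>a\<close> is, because \<open>a\<close>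
  divides a power of \<open>s\<close> and a power of \<open>a\<close> lies in \<open>(D : x)\<close>. Thus the union may be replaced by
  the clopen set \<open>{T. inv a \<in> T}\<close>, and the quotient rings form an intersection of clopen sets.

  Conversely, the constructible topology on the overrings is compact
  (\<open>compact_space_constructible_zariski\<close>). So if the quotient rings form a closed set, finitely many
  nonzero \<open>s \<in> (D : x)\<close>, and at least one, suffice for all the quotient rings containing \<open>x\<close>. If none of them had
  \<open>rad (s D) = rad (D : x)\<close>, then \<open>radical_avoidance\<close>, a form of prime avoidance, would give
  \<open>t \<in> (D : x)\<close> outside all these \<open>rad (s D)\<close>; the quotient ring \<open>D[1/t]\<close> would contain \<open>x\<close> without
  inverting any of these \<open>s\<close>.
\<close>

section \<open>Radicals of ideals and avoidance\<close>

lemma radical_mono: "I \<subseteq> J \<Longrightarrow> radical R I \<subseteq> radical R J"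
  by (auto simp: radical_def)

context cring
begin

lemma subset_radical: "ideal I R \<Longrightarrow> I \<subseteq> radical R I"
proof
  fix a assume I: "ideal I R" and a: "a \<in> I"
  then have "a [^] (1::nat) \<in> I" "a \<in> carrier R"
    using ideal.Icarr[OF I] by auto
  then show "a \<in> radical R I" unfolding radical_def by blast
qed

lemma radical_of_power:
  assumes "a \<in> carrier R" "n > 0" "a [^] (n::nat) \<in> radical R I"
  shows "a \<in> radical R I"
proof -
  obtain m where "m > 0" "a [^] (n * m) \<in> I"
    using assms by (auto simp: radical_def nat_pow_pow)
  then show ?thesis
    using assms(1,2) unfolding radical_def by (intro CollectI conjI exI[of _ "n * m"]) auto
qed

lemma radical_idem: "radical R (radical R I) = radical R I"
proof
  show "radical R (radical R I) \<subseteq> radical R I"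
    using radical_of_power by (auto simp: radical_def[of R "radical R I"])
  show "radical R I \<subseteq> radical R (radical R I)"
  proof
    fix a assume a: "a \<in> radical R I"
    then have "a \<in> carrier R" by (simp add: radical_def)
    then have "a [^] (1::nat) \<in> radical R I" using a by simp
    with \<open>a \<in> carrier R\<close> show "a \<in> radical R (radical R I)"
      unfolding radical_def[of R "radical R I"] by blast
  qed
qed

text \<open>
  By induction, \<open>(v + w) ^ n\<close> and \<open>v ^ n\<close> differ by an element of \<open>I\<close>. This keeps the proofs below
  free of the binomial theorem: instead of adding elements of a radical, one first passes to powers
  that lie in the ideal itself.
\<close>

lemma radical_add_ideal_element:
  assumes "ideal I R" "w \<in> I" "v \<in> carrier R"
  shows "v \<oplus> w \<in> radical R I \<longleftrightarrow> v \<in> radical R I"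
proof -
  interpret I: ideal I R by fact
  have pow: "\<exists>c\<in>I. (b \<oplus> d) [^] n = b [^] n \<oplus> c" if "b \<in> carrier R" "d \<in> I" for b d and n :: nat
  proof (induction n)
    case 0
    show ?case using I.zero_closed by (intro bexI[of _ \<zero>]) auto
  next
    case (Suc n)
    then obtain c where c: "c \<in> I" "(b \<oplus> d) [^] n = b [^] n \<oplus> c" by blast
    have cd: "c \<in> carrier R" "d \<in> carrier R" using c that I.Icarr by auto
    have "(b \<oplus> d) [^] Suc n = b [^] Suc n \<oplus> (b [^] n \<otimes> d \<oplus> c \<otimes> (b \<oplus> d))"
      using cd that c(2) by (simp add: l_distr r_distr a_ac)
    moreover have "b [^] n \<otimes> d \<oplus> c \<otimes> (b \<oplus> d) \<in> I"
      using c that cd by (intro I.a_closed I.I_l_closed I.I_r_closed) auto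
    ultimately show ?case by blast
  qed
  have imp: "b \<in> radical R I" if b: "b \<in> carrier R" "d \<in> I" "b \<oplus> d \<in> radical R I" for b d
  proof -
    obtain n :: nat where n: "n > 0" "(b \<oplus> d) [^] n \<in> I" using b by (auto simp: radical_def)
    obtain c where c: "c \<in> I" "(b \<oplus> d) [^] n = b [^] n \<oplus> c" using pow[OF b(1,2)] by blast
    have "b [^] n = (b \<oplus> d) [^] n \<ominus> c"
      using c b(1) I.Icarr by (simp add: minus_eq a_assoc r_neg)
    then have "b [^] n \<in> I" using n(2) c(1) by (simp add: minus_eq I.a_inv_closed)
    then show ?thesis using b n by (auto simp: radical_def)
  qed
  have "w \<in> carrier R" using assms I.Icarr by auto
  then have "v \<oplus> w \<oplus> \<ominus> w = v" using assms(3) by (simp add: a_assoc r_neg)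
  then show ?thesis
    using imp[of v w] imp[of "v \<oplus> w" "\<ominus> w"] assms(2,3) \<open>w \<in> carrier R\<close>
    by (auto simp: I.a_inv_closed)
qed

text \<open>
  Multiplying out: if \<open>u ^ n = a + b\<close> and \<open>u ^ m = a' + b'\<close> with \<open>a, a' \<in> A\<close>, then \<open>u ^ (n + m)\<close> is
  congruent to \<open>b b'\<close> modulo \<open>A\<close>, and \<open>b b'\<close> lies in every ideal that contains \<open>b\<close> or \<open>b'\<close>.
  The carrier is intersected with \<open>\<Inter>\<G>\<close> because \<open>\<Inter>{}\<close> is the universal set.
\<close>

lemma power_in_add_Inter:
  assumes "finite \<G>" "ideal A R" "\<And>J. J \<in> \<G> \<Longrightarrow> ideal J R" "u \<in> carrier R"
    and "\<And>J. J \<in> \<G> \<Longrightarrow> u \<in> radical R (A <+>\<^bsub>R\<^esub> J)"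
  shows "\<exists>n::nat. \<exists>a\<in>A. \<exists>b\<in>carrier R \<inter> \<Inter>\<G>. u [^] n = a \<oplus> b"
  using assms
proof (induction \<G>)
  case empty
  interpret A: ideal A R by fact
  have "u [^] (0::nat) = \<zero> \<oplus> \<one>" by simp
  then show ?case using A.zero_closed by blast
next
  case (insert J \<G>)
  interpret A: ideal A R by fact
  interpret J: ideal J R using insert.prems by simp
  obtain n :: nat and a b where ab: "a \<in> A" "b \<in> carrier R" "b \<in> \<Inter>\<G>" "u [^] n = a \<oplus> b"
    using insert by blast
  have "u \<in> radical R (A <+>\<^bsub>R\<^esub> J)" using insert.prems by blast
  then obtain m :: nat and a' b' where ab': "a' \<in> A" "b' \<in> J" "u [^] m = a' \<oplus> b'"
    unfolding radical_def set_add_def' by auto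
  have c: "a \<in> carrier R" "a' \<in> carrier R" "b' \<in> carrier R" using ab ab' A.Icarr J.Icarr by auto
  have "u [^] (n + m) = (a \<oplus> b) \<otimes> (a' \<oplus> b')"
    using insert.prems ab ab' by (simp flip: nat_pow_mult)
  also have "\<dots> = (a \<otimes> (a' \<oplus> b') \<oplus> b \<otimes> a') \<oplus> b \<otimes> b'"
    using c ab(2) by (simp add: l_distr r_distr a_ac)
  finally have eq: "u [^] (n + m) = (a \<otimes> (a' \<oplus> b') \<oplus> b \<otimes> a') \<oplus> b \<otimes> b'" .
  have 1: "a \<otimes> (a' \<oplus> b') \<oplus> b \<otimes> a' \<in> A"
    using ab ab' c by (intro A.a_closed A.I_l_closed A.I_r_closed) auto
  have "b \<otimes> b' \<in> L" if "L \<in> \<G>" for L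
    using ideal.I_r_closed[of L R b b'] insert.prems that ab c by auto
  then have 2: "b \<otimes> b' \<in> carrier R \<inter> \<Inter>(insert J \<G>)"
    using J.I_l_closed[OF ab'(2) ab(2)] c ab by auto
  show ?case using eq 1 2 by blast
qed

lemma set_add_upper:
  assumes "ideal I R" "ideal J R"
  shows "I \<subseteq> I <+>\<^bsub>R\<^esub> J" "J \<subseteq> I <+>\<^bsub>R\<^esub> J"
proof -
  interpret I: ideal I R by fact
  interpret J: ideal J R by fact
  show "I \<subseteq> I <+>\<^bsub>R\<^esub> J"
  proof
    fix a assume "a \<in> I"
    then have "a = a \<oplus> \<zero>" "\<zero> \<in> J" using I.Icarr J.zero_closed by auto
    with \<open>a \<in> I\<close> show "a \<in> I <+>\<^bsub>R\<^esub> J" unfolding set_add_def' by blast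
  qed
  show "J \<subseteq> I <+>\<^bsub>R\<^esub> J"
  proof
    fix a assume "a \<in> J"
    then have "a = \<zero> \<oplus> a" "\<zero> \<in> I" using J.Icarr I.zero_closed by auto
    with \<open>a \<in> J\<close> show "a \<in> I <+>\<^bsub>R\<^esub> J" unfolding set_add_def' by blast
  qed
qed

text \<open>
  Each \<open>J\<close> lies in a prime that does not contain \<open>I\<close>, and prime avoidance for these primes gives \<open>t\<close>.
  But no primes are needed if one argues by induction on the number of ideals. Single out \<open>J \<in> \<F>\<close> and let \<open>v \<in> I\<close> avoid the
  radicals of the others; the only problem is that some power of \<open>v\<close> may lie in \<open>J\<close>. If \<open>I\<close> has an
  element \<open>w\<close> in all the other ideals but outside \<open>rad J\<close>, then \<open>w + v ^ m\<close> avoids everything, as in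
  the classical proof. If there is no such \<open>w\<close>, then \<open>J\<close> can be merged with another ideal \<open>L\<close>:
  \<open>I\<close> is not inside \<open>rad (J + L)\<close> for some \<open>L\<close>, since otherwise a power of any \<open>u \<in> I\<close> would be
  congruent modulo \<open>J\<close> to an element of \<open>I\<close> in all the other ideals, hence \<open>u\<close> would be in \<open>rad J\<close>.
  Replacing \<open>J\<close> and \<open>L\<close> by \<open>J + L\<close> leaves fewer ideals.
\<close>

lemma radical_avoidance:
  assumes "ideal I R" "finite \<F>"
    and "\<And>J. J \<in> \<F> \<Longrightarrow> ideal J R" "\<And>J. J \<in> \<F> \<Longrightarrow> \<not> I \<subseteq> radical R J"
  shows "\<exists>t\<in>I. \<forall>J\<in>\<F>. t \<notin> radical R J"
  using assms(2-)
proof (induction "card \<F>" arbitrary: \<F> rule: less_induct)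
  case less
  interpret I: ideal I R by fact
  note IH = less.hyps
  show ?case
  proof (cases "\<F> = {}")
    case True
    then show ?thesis using I.zero_closed by blast
  next
    case False
    then obtain J where J: "J \<in> \<F>" by blast
    define \<G> where "\<G> = \<F> - {J}"
    have \<F>: "\<F> = insert J \<G>" and \<G>: "finite \<G>" "J \<notin> \<G>" using J less.prems by (auto simp: \<G>_def)
    have card\<F>: "card \<F> = Suc (card \<G>)" using \<F> \<G> by simp
    interpret J: ideal J R using J less.prems by blast
    have id: "ideal L R" if "L \<in> \<G>" for L using that less.prems \<F> by blast
    have "\<exists>v\<in>I. \<forall>L\<in>\<G>. v \<notin> radical R L"
      using less.prems \<F> card\<F> by (intro IH) auto
    then obtain v where v: "v \<in> I" "\<And>L. L \<in> \<G> \<Longrightarrow> v \<notin> radical R L" by blast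
    have vc: "v \<in> carrier R" using v I.Icarr by blast
    show ?thesis
    proof (cases "v \<in> radical R J")
      case False
      then show ?thesis using v \<F> by blast
    next
      case True
      then obtain m :: nat where m: "m > 0" "v [^] m \<in> J" by (auto simp: radical_def)
      have vmI: "v [^] m \<in> I"
      proof -
        obtain k where k: "m = Suc k" using m(1) gr0_conv_Suc by blast
        show ?thesis unfolding k using I.I_l_closed v vc by simp
      qed
      have vmL: "v [^] m \<notin> radical R L" if "L \<in> \<G>" for L
        using radical_of_power[OF vc m(1)] v(2)[OF that] by blast
      show ?thesis
      proof (cases "\<exists>w\<in>I \<inter> \<Inter>\<G>. w \<notin> radical R J")
        case True
        then obtain w where w: "w \<in> I" "w \<in> \<Inter>\<G>" "w \<notin> radical R J" by blast
        have wc: "w \<in> carrier R" using w I.Icarr by blast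
        have "w \<oplus> v [^] m \<notin> radical R J"
          using radical_add_ideal_element[OF J.ideal_axioms m(2) wc] w(3) by simp
        moreover have "w \<oplus> v [^] m \<notin> radical R L" if "L \<in> \<G>" for L
        proof -
          have "v [^] m \<oplus> w \<notin> radical R L"
            using radical_add_ideal_element[OF id[OF that], of w "v [^] m"] w(2) vmL vc that by auto
          then show ?thesis using vc wc by (simp add: a_comm)
        qed
        ultimately show ?thesis using \<F> w(1) vmI I.a_closed by blast
      next
        case False
        have "\<exists>L\<in>\<G>. \<not> I \<subseteq> radical R (J <+>\<^bsub>R\<^esub> L)"
        proof (rule ccontr)
          assume "\<not> ?thesis"
          then have all: "I \<subseteq> radical R (J <+>\<^bsub>R\<^esub> L)" if "L \<in> \<G>" for L using that by blast
          obtain u where u: "u \<in> I" "u \<notin> radical R J" using less.prems(3)[OF J] by blast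
          have uc: "u \<in> carrier R" using u I.Icarr by blast
          obtain n :: nat and a b where ab: "a \<in> J" "b \<in> carrier R" "b \<in> \<Inter>\<G>" "u [^] n = a \<oplus> b"
            using power_in_add_Inter[OF \<G>(1) J.ideal_axioms id uc] all u(1) by blast
          have ac: "a \<in> carrier R" using ab J.Icarr by blast
          \<comment> \<open>The extra factor \<open>u\<close> moves \<open>b\<close>, which is only known to lie in the other ideals, into \<open>I\<close>.\<close>
          have eq: "u [^] Suc n = u \<otimes> b \<oplus> u \<otimes> a"
            using ab(4) uc ab(2) ac by (simp add: l_distr r_distr a_comm m_comm)
          have "u \<otimes> b \<in> L" if "L \<in> \<G>" for L
            using ideal.I_l_closed[OF id[OF that], of b u] ab that uc by blast
          then have "u \<otimes> b \<in> radical R J" using False u ab I.I_r_closed by blast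
          then have "u [^] Suc n \<in> radical R J"
            unfolding eq using radical_add_ideal_element[OF J.ideal_axioms, of "u \<otimes> a" "u \<otimes> b"]
              J.I_l_closed[OF ab(1) uc] uc ab(2) by simp
          then show False using radical_of_power[OF uc, of "Suc n"] u(2) by blast
        qed
        then obtain L where L: "L \<in> \<G>" "\<not> I \<subseteq> radical R (J <+>\<^bsub>R\<^esub> L)" by blast
        define \<H> where "\<H> = insert (J <+>\<^bsub>R\<^esub> L) (\<G> - {L})"
        have "card \<H> < card \<F>"
          using \<G>(1) L(1) card\<F> card_insert_le_m1[of "card \<G>" "\<G> - {L}" "J <+>\<^bsub>R\<^esub> L"]
          by (auto simp: \<H>_def card_gt_0_iff less_Suc_eq_le)
        moreover have "ideal H R" "\<not> I \<subseteq> radical R H" if "H \<in> \<H>" for H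
          using that L less.prems \<F> add_ideals[OF J.ideal_axioms id[OF L(1)]] by (auto simp: \<H>_def)
        ultimately obtain t where t: "t \<in> I" "\<And>H. H \<in> \<H> \<Longrightarrow> t \<notin> radical R H"
          using IH[of \<H>] \<G>(1) by (auto simp: \<H>_def)
        have "t \<notin> radical R J" "t \<notin> radical R L"
          using t(2)[of "J <+>\<^bsub>R\<^esub> L"] set_add_upper[OF J.ideal_axioms id[OF L(1)]]
          by (auto simp: \<H>_def dest: radical_mono)
        then have "\<forall>H\<in>\<F>. t \<notin> radical R H"
          using t(2) \<F> by (auto simp: \<H>_def)
        then show ?thesis using t(1) by blast
      qed
    qed
  qed
qed

end


section \<open>Compactness of the constructible topology on overrings\<close>

context ring
begin

lemma generate_ring_finite_character:
  assumes "H \<subseteq> carrier R" "y \<in> generate_ring R H"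
  shows "\<exists>F. finite F \<and> F \<subseteq> H \<and> y \<in> generate_ring R F"
  using assms(2)
proof (induction rule: generate_ring.induct)
  case one
  then show ?case using generate_ring.one by blast
next
  case (incl h)
  have "h \<in> generate_ring R {h}" by (simp add: generate_ring.incl)
  then show ?case using incl by blast
next
  case (a_inv h)
  then obtain F where "finite F" "F \<subseteq> H" "h \<in> generate_ring R F" by blast
  then show ?case by (intro exI[of _ F]) (simp add: generate_ring.a_inv)
next
  case (eng_add h h')
  then obtain F F' where F: "finite F" "F \<subseteq> H" "h \<in> generate_ring R F"
    "finite F'" "F' \<subseteq> H" "h' \<in> generate_ring R F'" by blast
  then have "h \<in> generate_ring R (F \<union> F')" "h' \<in> generate_ring R (F \<union> F')"
    using mono_generate_ring[of _ "F \<union> F'"] assms(1) by blast+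
  then have "h \<oplus> h' \<in> generate_ring R (F \<union> F')"
    by (rule generate_ring.eng_add)
  moreover have "finite (F \<union> F')" "F \<union> F' \<subseteq> H" using F by auto
  ultimately show ?case by blast
next
  case (eng_mult h h')
  then obtain F F' where F: "finite F" "F \<subseteq> H" "h \<in> generate_ring R F"
    "finite F'" "F' \<subseteq> H" "h' \<in> generate_ring R F'" by blast
  then have "h \<in> generate_ring R (F \<union> F')" "h' \<in> generate_ring R (F \<union> F')"
    using mono_generate_ring[of _ "F \<union> F'"] assms(1) by blast+
  then have "h \<otimes> h' \<in> generate_ring R (F \<union> F')"
    by (rule generate_ring.eng_mult)
  moreover have "finite (F \<union> F')" "F \<union> F' \<subseteq> H" using F by auto
  ultimately show ?case by blast
qed

text \<open>
  \<open>generate_ring R (D \<union> P)\<close> is the least element \<open>D[P]\<close> of \<open>zariski_basic R D P\<close>; both compactness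
  statements below rest on it.
\<close>

lemma generate_ring_overring:
  assumes "D \<subseteq> carrier R" "P \<subseteq> carrier R"
  shows "generate_ring R (D \<union> P) \<in> zariski_basic R D P"
  using generate_ring_is_subring[of "D \<union> P"] generate_ring.incl[of _ "D \<union> P" R] assms
  by (auto simp: zariski_basic_def overrings_def)

lemma openin_zariski_basic:
  assumes "finite F" "F \<subseteq> carrier R"
  shows "openin (zariski_topology R D) (zariski_basic R D F)"
  unfolding zariski_topology_def using assms by (intro topology_generated_by_Basis) auto

text \<open>
  Open sets of overrings are closed under enlarging the overring. So a member of a cover that
  contains the least element \<open>D[F]\<close> already contains the whole set.
\<close>

lemma compactin_zariski_basic:
  assumes "D \<subseteq> carrier R" "F \<subseteq> carrier R"
  shows "compactin (zariski_topology R D) (zariski_basic R D F)"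
  unfolding compactin_def
proof (intro conjI allI impI)
  show "zariski_basic R D F \<subseteq> topspace (zariski_topology R D)"
    by (auto simp: zariski_basic_def)
  fix \<U> assume \<U>: "Ball \<U> (openin (zariski_topology R D)) \<and> zariski_basic R D F \<subseteq> \<Union>\<U>"
  let ?T = "generate_ring R (D \<union> F)"
  obtain U where U: "U \<in> \<U>" "?T \<in> U" using \<U> generate_ring_overring[OF assms] by blast
  then obtain \<F> where "U = (\<Union>G\<in>\<F>. zariski_basic R D G)"
    using \<U> by (meson openin_zariski_topology_iff)
  then obtain G where G: "?T \<in> zariski_basic R D G" "zariski_basic R D G \<subseteq> U" using U by blast
  have "?T \<subseteq> T" if "T \<in> zariski_basic R D F" for T
    using that generate_ring_min_subring1[of "D \<union> F" T] assms
    by (auto simp: zariski_basic_def overrings_def)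
  then have "zariski_basic R D F \<subseteq> zariski_basic R D G"
    using G(1) by (fastforce simp: zariski_basic_def)
  then show "\<exists>\<V>. finite \<V> \<and> \<V> \<subseteq> \<U> \<and> zariski_basic R D F \<subseteq> \<Union>\<V>"
    using U G by (intro exI[of _ "{U}"]) auto
qed

lemma clopen_constructible_zariski_basic:
  assumes "D \<subseteq> carrier R" "finite F" "F \<subseteq> carrier R"
  shows "openin (constructible_topology (zariski_topology R D)) (zariski_basic R D F)"
    and "closedin (constructible_topology (zariski_topology R D)) (zariski_basic R D F)"
  by (intro constructible_topology_clopen openin_zariski_basic compactin_zariski_basic assms)+

text \<open>
  The constructible topology is contained in the topology \<open>Z\<close> with the subbase of all sets
  \<open>{T. x \<in> T}\<close> and \<open>{T. x \<notin> T}\<close>, so it suffices that \<open>Z\<close> is compact, and by Alexander's theorem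
  only covers by subbasic sets matter. Let \<open>P\<close> be the set of the \<open>x\<close> for which \<open>{T. x \<notin> T}\<close> is in the
  cover. The overring \<open>D[P]\<close> lies in none of these sets, hence in some \<open>{T. y \<in> T}\<close> of the cover. That
  \<open>y\<close> is in \<open>D[P]\<close> needs only finitely many elements of \<open>P\<close>, and their sets together with
  \<open>{T. y \<in> T}\<close> cover everything.
\<close>

lemma compact_space_constructible_zariski:
  assumes D: "D \<subseteq> carrier R"
  shows "compact_space (constructible_topology (zariski_topology R D))"
proof -
  let ?X = "zariski_topology R D"
  let ?B = "\<lambda>x. zariski_basic R D {x}"
  define \<B> where "\<B> = ?B ` carrier R \<union> (\<lambda>x. overrings R D - ?B x) ` carrier R"
  define Z where "Z = topology (arbitrary union_of
    (finite intersection_of (\<lambda>S. S \<in> \<B>) relative_to overrings R D))"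
  have B_sub: "?B x \<subseteq> overrings R D" for x by (auto simp: zariski_basic_def)
  have top: "topspace Z = overrings R D" by (simp add: Z_def)
  have openZ: "openin Z S" if "S \<in> \<B>" for S
    using that B_sub
    by (auto simp: Z_def openin_subbase \<B>_def
             intro!: arbitrary_union_of_inc relative_to_subset_inc finite_intersection_of_inc)
  have "compact_space Z"
  proof (rule Alexander_subbase_alt[OF _ _ Z_def[symmetric]])
    show "overrings R D \<subseteq> \<Union>\<B>" using one_closed by (auto simp: \<B>_def)
  next
    fix \<C> assume \<C>: "\<C> \<subseteq> \<B>" "overrings R D \<subseteq> \<Union>\<C>"
    define P where "P = {x \<in> carrier R. overrings R D - ?B x \<in> \<C>}"
    have P: "P \<subseteq> carrier R" by (auto simp: P_def)
    let ?T = "generate_ring R (D \<union> P)"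
    have T: "?T \<in> overrings R D" "P \<subseteq> ?T"
      using generate_ring_overring[OF D P] by (auto simp: zariski_basic_def)
    then obtain S where S: "S \<in> \<C>" "?T \<in> S" using \<C>(2) by blast
    then consider y where "y \<in> carrier R" "S = ?B y"
      | x where "x \<in> carrier R" "S = overrings R D - ?B x"
      using \<C>(1) unfolding \<B>_def by blast
    then show "\<exists>\<C>'. finite \<C>' \<and> \<C>' \<subseteq> \<C> \<and> overrings R D \<subseteq> \<Union>\<C>'"
    proof cases
      case 1
      then have "y \<in> ?T" using S by (auto simp: zariski_basic_def)
      then obtain F where F: "finite F" "F \<subseteq> D \<union> P" "y \<in> generate_ring R F"
        using generate_ring_finite_character[of "D \<union> P" y] D P by blast
      let ?C = "insert S ((\<lambda>x. overrings R D - ?B x) ` (F \<inter> P))"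
      have "T \<in> ?B y" if "T \<in> overrings R D" "F \<inter> P \<subseteq> T" for T
      proof -
        have "F \<subseteq> T" "subring T R" using that F by (auto simp: overrings_def)
        then have "y \<in> T" using F(3) generate_ring_min_subring1[of F T] subringE(1) by blast
        then show ?thesis using that by (simp add: zariski_basic_def)
      qed
      then have "overrings R D \<subseteq> \<Union>?C"
        using 1 by (auto simp: zariski_basic_def)
      moreover have "?C \<subseteq> \<C>"
        using S by (auto simp: P_def)
      moreover have "finite ?C" using F(1) by simp
      ultimately show ?thesis by (intro exI[of _ ?C]) simp
    next
      case 2
      then have "x \<in> ?T" using S(1) T(2) by (auto simp: P_def)
      then show ?thesis using S(2) 2 T(1) by (auto simp: zariski_basic_def)
    qed
  qed
  have basicZ: "openin Z (zariski_basic R D F) \<and> closedin Z (zariski_basic R D F)"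
    if "finite F" "F \<subseteq> carrier R" for F
    using that
  proof (induction F)
    case empty
    have "zariski_basic R D {} = topspace Z" by (simp add: top zariski_basic_def)
    then show ?case by simp
  next
    case (insert x F)
    have "zariski_basic R D (insert x F) = ?B x \<inter> zariski_basic R D F"
      by (auto simp: zariski_basic_def)
    moreover have "openin Z (?B x)" "closedin Z (?B x)"
      using insert.prems B_sub by (auto simp: closedin_def top \<B>_def intro!: openZ)
    ultimately show ?case using insert by auto
  qed
  \<comment> \<open>A compact open set is a finite union of basic sets, each clopen in \<open>Z\<close>.\<close>
  have clopen: "openin Z U \<and> closedin Z U" if U: "openin ?X U" "compactin ?X U" for U
  proof -
    obtain \<F> where \<F>: "\<And>F. F \<in> \<F> \<Longrightarrow> finite F \<and> F \<subseteq> carrier R" "U = (\<Union>F\<in>\<F>. zariski_basic R D F)"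
      using U(1) unfolding openin_zariski_topology_iff by blast
    have "\<exists>\<V>. finite \<V> \<and> \<V> \<subseteq> zariski_basic R D ` \<F> \<and> U \<subseteq> \<Union>\<V>"
      using \<F> openin_zariski_basic by (intro compactinD[OF U(2)]) auto
    then obtain \<V> where \<V>: "finite \<V>" "\<V> \<subseteq> zariski_basic R D ` \<F>" "U \<subseteq> \<Union>\<V>" by blast
    then have "U = \<Union>\<V>" using \<F>(2) by blast
    moreover have "openin Z V" "closedin Z V" if V: "V \<in> \<V>" for V
    proof -
      obtain F where "F \<in> \<F>" "V = zariski_basic R D F" using V \<V>(2) by blast
      then show "openin Z V" "closedin Z V" using basicZ \<F>(1) by simp_all
    qed
    then have "openin Z (\<Union>\<V>)" "closedin Z (\<Union>\<V>)"
      using \<V>(1) by (simp_all add: openin_Union closedin_Union)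
    ultimately show ?thesis by simp
  qed
  have "openin Z V" if "openin (constructible_topology ?X) V" for V
    by (rule constructible_topology_coarsest[OF _ clopen that]) (simp_all add: top)
  then have "\<forall>U\<in>\<U>. openin Z U" if "\<forall>U\<in>\<U>. openin (constructible_topology ?X) U" for \<U>
    using that by blast
  moreover have "topspace (constructible_topology ?X) = topspace Z" by (simp add: top)
  ultimately show ?thesis
    using \<open>compact_space Z\<close> unfolding compact_space by (metis (no_types, lifting))
qed

end


section \<open>Quotient rings among the overrings\<close>

locale domain_in_quotient_field = field K for K (structure) +
  fixes D
  assumes quotient_field: "quotient_field_of K D"
begin

lemma subdomain: "subdomain D K"
  using quotient_field by (simp add: quotient_field_of_def)

lemmas D_closed = subdomainE(2,3,5-7)[OF subdomain]

lemma D_subset: "D \<subseteq> carrier K"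
  using subdomainE(1)[OF subdomain] .

lemma D_carrier [simp]: "d \<in> D \<Longrightarrow> d \<in> carrier K"
  using D_subset by blast

lemma cring_D: "cring (K\<lparr>carrier := D\<rparr>)"
  using subdomain_is_domain[OF subdomain] by (simp add: domain_def)

lemma power_closed: "d \<in> D \<Longrightarrow> d [^] (n::nat) \<in> D"
  by (induction n) (auto simp: D_closed)

lemma radical_eq: "radical (K\<lparr>carrier := D\<rparr>) I = {a \<in> D. \<exists>n::nat. n > 0 \<and> a [^] n \<in> I}"
  by (simp add: radical_def nat_pow_consistent[symmetric])

lemma principal_eq: "PIdl\<^bsub>K\<lparr>carrier := D\<rparr>\<^esub> a = {d \<otimes> a | d. d \<in> D}"
  by (simp add: cgenideal_def)

lemma inv_nonzero:
  assumes "s \<in> carrier K" "s \<noteq> \<zero>"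
  shows "inv s \<in> carrier K" "inv s \<otimes> s = \<one>" "s \<otimes> inv s = \<one>"
  using assms field_Units by auto

lemma inv_cancel:
  assumes "s \<in> carrier K" "s \<noteq> \<zero>" "x \<in> carrier K"
  shows "inv s \<otimes> (s \<otimes> x) = x" "s \<otimes> (inv s \<otimes> x) = x"
  using inv_nonzero[OF assms(1,2)] assms by (simp_all flip: m_assoc)

lemma inv_mult:
  assumes "s \<in> carrier K" "s \<noteq> \<zero>" "t \<in> carrier K" "t \<noteq> \<zero>"
  shows "inv (s \<otimes> t) = inv s \<otimes> inv t"
proof (rule comm_inv_char)
  have "s \<otimes> t \<otimes> (inv s \<otimes> inv t) = (s \<otimes> inv s) \<otimes> (t \<otimes> inv t)"
    using assms inv_nonzero(1) by (simp add: m_ac)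
  then show "s \<otimes> t \<otimes> (inv s \<otimes> inv t) = \<one>"
    using assms inv_nonzero(3) by simp
qed (use assms inv_nonzero(1) in auto)

lemma localization_quotient_overring:
  assumes S: "submonoid S (K\<lparr>carrier := D\<rparr>)" "\<zero> \<notin> S"
  shows "localization K D S \<in> quotient_overrings K D"
proof -
  interpret S: submonoid S "K\<lparr>carrier := D\<rparr>" by fact
  have SD: "s \<in> D" "s \<in> carrier K" "s \<noteq> \<zero>" if "s \<in> S" for s
    using that S.subset S(2) by auto
  have S1: "\<one> \<in> S" and Sm: "\<And>s t. s \<in> S \<Longrightarrow> t \<in> S \<Longrightarrow> s \<otimes> t \<in> S"
    using S.one_closed S.m_closed by auto
  have fracI: "inv s \<otimes> d \<in> localization K D S" if "s \<in> S" "d \<in> D" for s d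
    using that by (auto simp: localization_def)
  have "subring (localization K D S) K"
  proof (rule subringI)
    show "localization K D S \<subseteq> carrier K"
      using SD inv_nonzero(1) by (auto simp: localization_def)
    show "\<one> \<in> localization K D S" using fracI[OF S1 D_closed(2)] by simp
  next
    fix x assume "x \<in> localization K D S"
    then obtain s d where x: "x = inv s \<otimes> d" "s \<in> S" "d \<in> D" by (auto simp: localization_def)
    then have "\<ominus> x = inv s \<otimes> (\<ominus> d)" using SD inv_nonzero(1) by (simp add: r_minus)
    then show "\<ominus> x \<in> localization K D S" using fracI x D_closed(3) by simp
  next
    fix x y assume "x \<in> localization K D S" "y \<in> localization K D S"
    then obtain s d t e where x: "x = inv s \<otimes> d" "s \<in> S" "d \<in> D"
      and y: "y = inv t \<otimes> e" "t \<in> S" "e \<in> D" by (auto simp: localization_def)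
    note c = x(2,3) y(2,3) SD inv_nonzero(1) D_closed Sm
    have "x \<otimes> y = inv (s \<otimes> t) \<otimes> (d \<otimes> e)"
      unfolding x y using c by (simp add: inv_mult m_ac)
    then show "x \<otimes> y \<in> localization K D S" using fracI c by simp
    have "inv (s \<otimes> t) \<otimes> (d \<otimes> t \<oplus> e \<otimes> s) = inv s \<otimes> (inv t \<otimes> (t \<otimes> d)) \<oplus> inv t \<otimes> (inv s \<otimes> (s \<otimes> e))"
      using c by (simp add: inv_mult r_distr m_ac)
    also have "\<dots> = x \<oplus> y" unfolding x y using c by (simp add: inv_cancel)
    finally have "x \<oplus> y = inv (s \<otimes> t) \<otimes> (d \<otimes> t \<oplus> e \<otimes> s)" ..
    then show "x \<oplus> y \<in> localization K D S" using fracI c by simp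
  qed
  moreover have "D \<subseteq> localization K D S"
  proof
    fix d assume "d \<in> D"
    then show "d \<in> localization K D S" using fracI[OF S1, of d] by simp
  qed
  ultimately show ?thesis using S by (auto simp: quotient_overrings_def overrings_def)
qed

text \<open>
  If an overring \<open>T\<close> is a localization at all, then it is the one at the largest candidate, the set of
  all nonzero \<open>s \<in> D\<close> that are invertible in \<open>T\<close>. This removes the quantifier over multiplicative sets: \<open>T\<close> is a quotient
  ring iff each of its elements has a denominator that is invertible in \<open>T\<close>.
\<close>

lemma quotient_overring_iff:
  assumes T: "T \<in> overrings K D"
  shows "T \<in> quotient_overrings K D \<longleftrightarrow>
    (\<forall>x\<in>T. \<exists>s\<in>colon_ideal K D x - {\<zero>}. inv s \<in> T)"
    (is "_ \<longleftrightarrow> ?frac")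
proof
  assume "T \<in> quotient_overrings K D"
  then obtain S where S: "submonoid S (K\<lparr>carrier := D\<rparr>)" "\<zero> \<notin> S" "T = localization K D S"
    by (auto simp: quotient_overrings_def)
  interpret S: submonoid S "K\<lparr>carrier := D\<rparr>" by fact
  show ?frac
  proof
    fix x assume "x \<in> T"
    then obtain s d where x: "x = inv s \<otimes> d" "s \<in> S" "d \<in> D"
      using S(3) by (auto simp: localization_def)
    have s: "s \<in> D" "s \<noteq> \<zero>" using x S.subset S(2) by auto
    have "s \<in> colon_ideal K D x"
      using s x by (simp add: colon_ideal_def inv_cancel)
    moreover have "inv s = inv s \<otimes> \<one>" using s inv_nonzero(1) by simp
    then have "inv s \<in> T" unfolding S(3) localization_def using x(2) D_closed(2) by blast
    ultimately show "\<exists>s\<in>colon_ideal K D x - {\<zero>}. inv s \<in> T" using s by blast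
  qed
next
  assume frac: ?frac
  have sub: "subring T K" "D \<subseteq> T" using T by (auto simp: overrings_def)
  note T_closed = subringE[OF sub(1)]
  define S where "S = {s \<in> D - {\<zero>}. inv s \<in> T}"
  have "submonoid S (K\<lparr>carrier := D\<rparr>)"
    using D_closed T_closed(3,6) inv_mult
    by unfold_locales (auto simp: S_def integral_iff)
  moreover have "T = localization K D S"
  proof
    show "T \<subseteq> localization K D S"
    proof
      fix x assume x: "x \<in> T"
      then obtain s where s: "s \<in> D" "s \<otimes> x \<in> D" "s \<noteq> \<zero>" "inv s \<in> T"
        using frac by (auto simp: colon_ideal_def)
      have "x = inv s \<otimes> (s \<otimes> x)" using s x T_closed(1) by (auto simp: inv_cancel)
      then show "x \<in> localization K D S"
        using s unfolding localization_def S_def by blast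
    qed
    show "localization K D S \<subseteq> T"
      using sub(2) T_closed(6) by (auto simp: localization_def S_def)
  qed
  moreover have "\<zero> \<notin> S" by (simp add: S_def)
  ultimately show "T \<in> quotient_overrings K D" using T by (auto simp: quotient_overrings_def)
qed

lemma colon_ideal_nonzero:
  assumes "x \<in> carrier K"
  shows "\<exists>s\<in>colon_ideal K D x. s \<noteq> \<zero>"
proof -
  obtain c b where "c \<in> D" "b \<in> D" "b \<noteq> \<zero>" "x = c \<otimes> inv b"
    using quotient_field assms unfolding quotient_field_of_def by blast
  then have "b \<otimes> x = c" "b \<in> D" "b \<noteq> \<zero>"
    using inv_nonzero(1)[of b] by (simp_all add: m_comm[of c] inv_cancel)
  then show ?thesis using \<open>c \<in> D\<close> by (auto simp: colon_ideal_def)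
qed

text \<open>
  If \<open>s ^ n = d * a\<close>, then \<open>inv s ^ n * d\<close> is the inverse of \<open>a\<close>: a divisor of a power of a unit is a unit.
\<close>

lemma inverse_in_overring_if_divides_power:
  assumes T: "T \<in> overrings K D" and s: "s \<in> D" "s \<noteq> \<zero>" "inv s \<in> T"
    and a: "a \<in> D" "s \<in> radical (K\<lparr>carrier := D\<rparr>) (PIdl\<^bsub>K\<lparr>carrier := D\<rparr>\<^esub> a)"
  shows "a \<noteq> \<zero>" "inv a \<in> T"
proof -
  have T_closed: "\<one> \<in> T" "\<And>x y. x \<in> T \<Longrightarrow> y \<in> T \<Longrightarrow> x \<otimes> y \<in> T" "D \<subseteq> T"
    using T subringE(3,6) by (auto simp: overrings_def)
  have pow: "inv s [^] n \<otimes> s [^] n = \<one>" "inv s [^] n \<in> T" for n :: nat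
  proof -
    show "inv s [^] n \<otimes> s [^] n = \<one>"
      using s inv_nonzero[of s] by (simp flip: nat_pow_distrib)
    show "inv s [^] n \<in> T" by (induction n) (use T_closed s in auto)
  qed
  obtain n :: nat and d where d: "d \<in> D" "s [^] n = d \<otimes> a"
    using a(2) by (auto simp: radical_eq principal_eq)
  have c: "inv s [^] n \<in> carrier K" using s inv_nonzero(1)[of s] by simp
  have eq: "a \<otimes> (inv s [^] n \<otimes> d) = \<one>"
    using pow(1)[of n] d a(1) c by (simp add: m_ac)
  then show "a \<noteq> \<zero>" using c d by auto
  have "inv a = inv s [^] n \<otimes> d" using eq c d a(1) by (intro comm_inv_char) auto
  then show "inv a \<in> T" using T_closed pow(2) d by auto
qed

lemma powers_submonoid:
  assumes "t \<in> D" "t \<noteq> \<zero>"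
  shows "submonoid (range (\<lambda>n::nat. t [^] n)) (K\<lparr>carrier := D\<rparr>)"
    and "\<zero> \<notin> range (\<lambda>n::nat. t [^] n)"
proof -
  show "submonoid (range (\<lambda>n::nat. t [^] n)) (K\<lparr>carrier := D\<rparr>)"
  proof
    show "\<one>\<^bsub>K\<lparr>carrier := D\<rparr>\<^esub> \<in> range (\<lambda>n::nat. t [^] n)"
      by (auto intro!: image_eqI[of _ _ 0])
  qed (use assms power_closed in \<open>auto simp: nat_pow_mult\<close>)
  have "t [^] n \<noteq> \<zero>" for n :: nat
    by (induction n) (use assms in \<open>auto simp: integral_iff\<close>)
  then show "\<zero> \<notin> range (\<lambda>n::nat. t [^] n)" by (metis imageE)
qed

section \<open>Proconstructibility of the set of quotient rings\<close>

text \<open>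
  With \<open>rad (D : x) = rad (a D)\<close>, the element \<open>x\<close> has a denominator invertible in \<open>T\<close> exactly when \<open>a\<close>
  is invertible in \<open>T\<close>. So the condition that an element \<open>x\<close> of \<open>T\<close> imposes on a quotient ring \<open>T\<close>
  becomes membership in the clopen set \<open>C x = {T. x \<notin> T} \<union> {T. inv a \<in> T}\<close>, and the set of quotient
  rings is the intersection of these.
\<close>

lemma proconstructible_if_principal_radicals:
  assumes "\<And>x. x \<in> carrier K \<Longrightarrow> \<exists>a\<in>D. radical (K\<lparr>carrier := D\<rparr>) (colon_ideal K D x) =
    radical (K\<lparr>carrier := D\<rparr>) (PIdl\<^bsub>K\<lparr>carrier := D\<rparr>\<^esub> a)"
  shows "proconstructible_in (zariski_topology K D) (quotient_overrings K D)"
proof -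
  obtain a where a: "\<And>x. x \<in> carrier K \<Longrightarrow> a x \<in> D"
    "\<And>x. x \<in> carrier K \<Longrightarrow> radical (K\<lparr>carrier := D\<rparr>) (colon_ideal K D x) =
      radical (K\<lparr>carrier := D\<rparr>) (PIdl\<^bsub>K\<lparr>carrier := D\<rparr>\<^esub> (a x))"
    using assms by metis
  interpret R: cring "K\<lparr>carrier := D\<rparr>" by (rule cring_D)
  let ?Y = "constructible_topology (zariski_topology K D)"
  have in_rad: "s \<in> radical (K\<lparr>carrier := D\<rparr>) (PIdl\<^bsub>K\<lparr>carrier := D\<rparr>\<^esub> (a x))"
    if "x \<in> carrier K" "s \<in> colon_ideal K D x" for s x
    using R.subset_radical[OF colon_ideal_ideal[OF quotient_field that(1)]] a(2) that by blast
  have nz: "a x \<noteq> \<zero>" if x: "x \<in> carrier K" for x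
  proof -
    obtain s where s: "s \<in> colon_ideal K D x" "s \<noteq> \<zero>" using colon_ideal_nonzero[OF x] by blast
    \<comment> \<open>In the overring \<open>K\<close>, the nonzero \<open>s\<close> is invertible, hence so is \<open>a x\<close>.\<close>
    have "carrier K \<in> overrings K D" using D_subset carrier_is_subring by (simp add: overrings_def)
    then show ?thesis
      using inverse_in_overring_if_divides_power(1)[OF _ _ s(2) _ a(1)[OF x] in_rad[OF x s(1)]]
        s inv_nonzero(1) by (auto simp: colon_ideal_def)
  qed
  have power: "\<exists>n::nat. n > 0 \<and> a x [^] n \<in> colon_ideal K D x" if x: "x \<in> carrier K" for x
  proof -
    have "a x \<in> radical (K\<lparr>carrier := D\<rparr>) (colon_ideal K D x)"
      unfolding a(2)[OF x]
      using R.subset_radical[OF R.cgenideal_ideal] R.cgenideal_self a(1)[OF x] by auto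
    then show ?thesis by (auto simp: radical_eq)
  qed
  define C where "C x = (overrings K D - zariski_basic K D {x}) \<union> zariski_basic K D {inv (a x)}" for x
  have "quotient_overrings K D = (\<Inter>x\<in>carrier K. C x)"
  proof (intro equalityI subsetI INT_I)
    fix T x assume T: "T \<in> quotient_overrings K D" and x: "x \<in> carrier K"
    have T': "T \<in> overrings K D" using T by (auto simp: quotient_overrings_def)
    show "T \<in> C x"
    proof (cases "x \<in> T")
      case True
      then obtain s where "s \<in> colon_ideal K D x" "s \<noteq> \<zero>" "inv s \<in> T"
        using T quotient_overring_iff[OF T'] by blast
      then have "inv (a x) \<in> T"
        using inverse_in_overring_if_divides_power(2)[OF T' _ _ _ a(1)[OF x] in_rad[OF x]]
        by (auto simp: colon_ideal_def)
      then show ?thesis using T' by (auto simp: C_def zariski_basic_def)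
    qed (use T' in \<open>auto simp: C_def zariski_basic_def\<close>)
  next
    fix T assume T: "T \<in> (\<Inter>x\<in>carrier K. C x)"
    then have T': "T \<in> overrings K D" using one_closed by (auto simp: C_def zariski_basic_def)
    have "\<exists>s\<in>colon_ideal K D x - {\<zero>}. inv s \<in> T" if "x \<in> T" for x
    proof -
      have x: "x \<in> carrier K" using that T' subringE(1) by (auto simp: overrings_def)
      have inv: "inv (a x) \<in> T" using T x that T' by (auto simp: C_def zariski_basic_def)
      obtain n :: nat where n: "n > 0" "a x [^] n \<in> colon_ideal K D x" using power[OF x] by blast
      have rad: "a x [^] n \<in> radical (K\<lparr>carrier := D\<rparr>) (PIdl\<^bsub>K\<lparr>carrier := D\<rparr>\<^esub> (a x [^] n))"
        using R.subset_radical[OF R.cgenideal_ideal] R.cgenideal_self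
          power_closed[OF a(1)[OF x]] by auto
      have "a x \<in> radical (K\<lparr>carrier := D\<rparr>) (PIdl\<^bsub>K\<lparr>carrier := D\<rparr>\<^esub> (a x [^] n))"
        using R.radical_of_power[of "a x" n] rad n(1) a(1)[OF x]
        by (simp add: nat_pow_consistent[symmetric])
      then have "a x [^] n \<noteq> \<zero>" "inv (a x [^] n) \<in> T"
        using inverse_in_overring_if_divides_power[OF T' a(1)[OF x] nz[OF x] inv]
          power_closed[OF a(1)[OF x]] by blast+
      then show ?thesis using n(2) by blast
    qed
    then show "T \<in> quotient_overrings K D" using quotient_overring_iff[OF T'] by blast
  qed
  moreover have "closedin ?Y (C x)" if x: "x \<in> carrier K" for x
  proof -
    have "closedin ?Y (overrings K D - zariski_basic K D {x})"
      using clopen_constructible_zariski_basic(1)[OF D_subset, of "{x}"] x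
      by (metis closedin_diff closedin_topspace empty_subsetI finite.emptyI finite_insert
          insert_subset topspace_constructible_topology topspace_zariski_topology)
    moreover have "closedin ?Y (zariski_basic K D {inv (a x)})"
      using clopen_constructible_zariski_basic(2)[OF D_subset, of "{inv (a x)}"]
        inv_nonzero(1)[OF _ nz[OF x]] a(1)[OF x] by simp
    ultimately show ?thesis unfolding C_def by (rule closedin_Un)
  qed
  ultimately show ?thesis
    unfolding proconstructible_in_def using one_closed
    by (auto intro!: closedin_INT)
qed

text \<open>
  The quotient rings containing \<open>x\<close> form a closed, hence compact, set in the constructible topology.
  It is covered by the open sets \<open>{T. inv s \<in> T}\<close>, where \<open>s\<close> ranges over the denominators of \<open>x\<close>.
\<close>

lemma finitely_many_inverses_if_proconstructible:
  assumes closed: "proconstructible_in (zariski_topology K D) (quotient_overrings K D)"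
    and x: "x \<in> carrier K"
  shows "\<exists>A. finite A \<and> A \<subseteq> colon_ideal K D x - {\<zero>} \<and>
    (\<forall>T\<in>quotient_overrings K D. x \<in> T \<longrightarrow> (\<exists>s\<in>A. inv s \<in> T))"
proof -
  let ?Y = "constructible_topology (zariski_topology K D)"
  let ?I = "colon_ideal K D x - {\<zero>}"
  let ?\<U> = "(\<lambda>s. zariski_basic K D {inv s}) ` ?I"
  have "compactin ?Y (quotient_overrings K D \<inter> zariski_basic K D {x})"
    using closed clopen_constructible_zariski_basic(2)[OF D_subset, of "{x}"] x
    by (intro closedin_compact_space compact_space_constructible_zariski D_subset closedin_Int)
      (auto simp: proconstructible_in_def)
  moreover have "openin ?Y U" if "U \<in> ?\<U>" for U
    using that inv_nonzero(1)
    by (auto simp: colon_ideal_def intro!: clopen_constructible_zariski_basic(1) D_subset)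
  moreover have "quotient_overrings K D \<inter> zariski_basic K D {x} \<subseteq> \<Union>?\<U>"
  proof
    fix T assume T: "T \<in> quotient_overrings K D \<inter> zariski_basic K D {x}"
    then have "T \<in> overrings K D" "x \<in> T" by (auto simp: zariski_basic_def)
    then show "T \<in> \<Union>?\<U>" using quotient_overring_iff[of T] T by (auto simp: zariski_basic_def)
  qed
  ultimately obtain \<V> where \<V>: "finite \<V>" "\<V> \<subseteq> ?\<U>"
    "quotient_overrings K D \<inter> zariski_basic K D {x} \<subseteq> \<Union>\<V>"
    using compactinD[of ?Y _ ?\<U>] by meson
  obtain A where A: "A \<subseteq> ?I" "finite A" "\<V> = (\<lambda>s. zariski_basic K D {inv s}) ` A"
    using finite_subset_image[OF \<V>(1,2)] by blast
  have "\<exists>s\<in>A. inv s \<in> T" if "T \<in> quotient_overrings K D" "x \<in> T" for T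
    using that \<V>(3) unfolding A(3) by (auto simp: zariski_basic_def quotient_overrings_def)
  then show ?thesis using A by blast
qed

text \<open>
  Let \<open>A\<close> be a finite set of denominators of \<open>x\<close> such that every quotient ring containing \<open>x\<close>
  inverts an element of \<open>A\<close>. If no \<open>s \<in> A\<close> satisfied \<open>(D : x) \<subseteq> rad (s D)\<close>, then by avoidance some
  single \<open>t \<in> (D : x)\<close> would lie in none of the \<open>rad (s D)\<close>. But then \<open>D[1/t]\<close> is a quotient ring
  containing \<open>x\<close>, and it inverts some \<open>s \<in> A\<close>, which means that \<open>s\<close> divides a power of \<open>t\<close>,
  that is, \<open>t \<in> rad (s D)\<close>. The inclusion \<open>rad (s D) \<subseteq> rad (D : x)\<close> is clear from \<open>s \<in> (D : x)\<close>.
\<close>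

lemma principal_radical_if_proconstructible:
  assumes closed: "proconstructible_in (zariski_topology K D) (quotient_overrings K D)"
    and x: "x \<in> carrier K"
  shows "\<exists>a\<in>D. radical (K\<lparr>carrier := D\<rparr>) (colon_ideal K D x) =
    radical (K\<lparr>carrier := D\<rparr>) (PIdl\<^bsub>K\<lparr>carrier := D\<rparr>\<^esub> a)"
proof -
  interpret R: cring "K\<lparr>carrier := D\<rparr>" by (rule cring_D)
  let ?rad = "radical (K\<lparr>carrier := D\<rparr>)"
  let ?P = "\<lambda>a. PIdl\<^bsub>K\<lparr>carrier := D\<rparr>\<^esub> a"
  let ?I = "colon_ideal K D x"
  have I: "ideal ?I (K\<lparr>carrier := D\<rparr>)" by (rule colon_ideal_ideal[OF quotient_field x])
  have ID: "s \<in> D" if "s \<in> ?I" for s using that by (simp add: colon_ideal_def)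
  obtain A where A: "finite A" "A \<subseteq> ?I - {\<zero>}"
    "\<And>T. T \<in> quotient_overrings K D \<Longrightarrow> x \<in> T \<Longrightarrow> \<exists>s\<in>A. inv s \<in> T"
    using finitely_many_inverses_if_proconstructible[OF closed x] by blast
  obtain b where b: "b \<in> ?I" "b \<noteq> \<zero>" using colon_ideal_nonzero[OF x] by blast
  \<comment> \<open>The nonzero \<open>b\<close> is added so that the avoiding element \<open>t\<close> is nonzero even when \<open>A\<close> is empty:
    zero lies in \<open>rad (b D)\<close>.\<close>
  have "\<exists>s\<in>insert b A. ?I \<subseteq> ?rad (?P s)"
  proof (rule ccontr)
    assume "\<not> ?thesis"
    then have "\<exists>t\<in>?I. \<forall>J\<in>?P ` insert b A. t \<notin> ?rad J"
      using A b ID by (intro R.radical_avoidance I) (auto intro!: R.cgenideal_ideal)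
    then obtain t where t: "t \<in> ?I" "\<And>s. s \<in> insert b A \<Longrightarrow> t \<notin> ?rad (?P s)" by blast
    have tD: "t \<in> D" using t ID by blast
    have "\<zero> \<in> ?rad (?P b)"
      using R.subset_radical[OF R.cgenideal_ideal[of b]] ID[OF b(1)]
        additive_subgroup.zero_closed[OF ideal.axioms(1)[OF R.cgenideal_ideal[of b]]] by auto
    then have t0: "t \<noteq> \<zero>" using t(2)[of b] by auto
    let ?T = "localization K D (range (\<lambda>n::nat. t [^] n))"
    have T: "?T \<in> quotient_overrings K D"
      using localization_quotient_overring powers_submonoid[OF tD t0] by blast
    have "x = inv (t [^] (1::nat)) \<otimes> (t \<otimes> x)" using tD t0 x by (simp add: inv_cancel)
    then have "x \<in> ?T" using t(1) unfolding localization_def colon_ideal_def by blast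
    then obtain s where s: "s \<in> A" "inv s \<in> ?T" using A(3) T by blast
    have s': "s \<in> D" "s \<noteq> \<zero>" using s(1) A(2) ID by auto
    obtain n :: nat and d where d: "d \<in> D" "inv s = inv (t [^] n) \<otimes> d"
      using s(2) by (auto simp: localization_def)
    have tn: "t [^] n \<in> D" "t [^] n \<noteq> \<zero>"
      using power_closed[OF tD] powers_submonoid(2)[OF tD t0] by (metis rangeI)+
    have "t [^] n = t [^] n \<otimes> (inv s \<otimes> s)" using tn s' inv_nonzero(2)[of s] by simp
    also have "\<dots> = d \<otimes> s"
      unfolding d(2) using tn s' d(1) inv_nonzero(1)[of "t [^] n"] by (simp add: m_assoc inv_cancel)
    \<comment> \<open>The exponent is raised because \<open>n\<close> may be zero, while radicals use positive exponents.\<close>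
    finally have "t [^] Suc n = (t \<otimes> d) \<otimes> s" using tD s' d(1) by (simp add: m_ac)
    moreover have "t \<otimes> d \<in> D" using tD d(1) D_closed by blast
    ultimately have "t \<in> ?rad (?P s)"
      unfolding radical_eq principal_eq using tD by blast
    then show False using t(2) s(1) by blast
  qed
  then obtain s where s: "s \<in> insert b A" "?I \<subseteq> ?rad (?P s)" by blast
  have sI: "s \<in> ?I" using s(1) A(2) b by blast
  have "?rad ?I \<subseteq> ?rad (?P s)"
    using radical_mono[OF s(2)] R.radical_idem by blast
  moreover have "?rad (?P s) \<subseteq> ?rad ?I"
    by (intro radical_mono R.cgenideal_minimal I sI)
  ultimately show ?thesis using ID[OF sI] by blast
qed

end

theorem theorem4p4:
  fixes K :: "('a, 'b) ring_scheme" and D :: "'a set"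
  assumes "quotient_field_of K D"
  shows "proconstructible_in (zariski_topology K D) (quotient_overrings K D) \<longleftrightarrow>
    (\<forall>x\<in>carrier K. \<exists>a\<in>D.
       radical (K\<lparr>carrier := D\<rparr>) (colon_ideal K D x) =
       radical (K\<lparr>carrier := D\<rparr>) (PIdl\<^bsub>K\<lparr>carrier := D\<rparr>\<^esub> a))"
proof -
  interpret domain_in_quotient_field K D
    using assms
    by (simp add: domain_in_quotient_field_def domain_in_quotient_field_axioms_def quotient_field_of_def)
  show ?thesis
    using proconstructible_if_principal_radicals principal_radical_if_proconstructible by blast
qed

end
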